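(* Let $k, k'$ be fields of characteristic $\ne 2$. If $m_{i,1}(k) = m_{i,1}(k')$ for all integers $i \geq 1$, then $u(k) = u(k')$.
   Context: All quadratic forms are regular; $i_W(q)$ is the Witt index of $q$. $u(k)$ is the maximal dimension of an anisotropic quadratic form over $k$ ($\infty$ if there is no maximum). For integers $i,j\ge1$, $m_{i,j}(k)$ is the infimum of $\dim q \ge 1$ over quadratic forms $q$ over $k$ such that $i_W(q) < j$ and $i_W(q \perp \sigma_i) \geq j$ for every $i$-dimensional quadratic form $\sigma_i$ over $k$, with the infimum of the empty set equal to $\infty$. *)

theory Defs
  imports
    "Jordan_Normal_Form.Matrix"
    "HOL-Library.Extended_Nat"
begin

text \<open>
  An n-dimensional quadratic form over a field \<open>k\<close> is a quadratic map on the coordinate space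
  \<open>k\<^sup>n = carrier_vec n\<close>.  The dimension is passed as a separate argument; the values of the map
  outside \<open>carrier_vec n\<close> are never inspected.
\<close>

definition polar :: "('a :: field vec \<Rightarrow> 'a) \<Rightarrow> 'a vec \<Rightarrow> 'a vec \<Rightarrow> 'a" where
  "polar q v w = q (v + w) - q v - q w"

text \<open>Linearity of the polar form is required in the left argument only, as it is symmetric.\<close>

definition quadratic_form :: "nat \<Rightarrow> ('a :: field vec \<Rightarrow> 'a) \<Rightarrow> bool" where
  "quadratic_form n q \<longleftrightarrow>
     (\<forall>c. \<forall>v \<in> carrier_vec n. q (c \<cdot>\<^sub>v v) = c\<^sup>2 * q v) \<and>
     (\<forall>u \<in> carrier_vec n. \<forall>v \<in> carrier_vec n. \<forall>w \<in> carrier_vec n.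
        polar q (u + v) w = polar q u w + polar q v w) \<and>
     (\<forall>c. \<forall>v \<in> carrier_vec n. \<forall>w \<in> carrier_vec n.
        polar q (c \<cdot>\<^sub>v v) w = c * polar q v w)"

definition regular_form :: "nat \<Rightarrow> ('a :: field vec \<Rightarrow> 'a) \<Rightarrow> bool" where
  "regular_form n q \<longleftrightarrow> quadratic_form n q \<and>
     (\<forall>v \<in> carrier_vec n. (\<forall>w \<in> carrier_vec n. polar q v w = 0) \<longrightarrow> v = 0\<^sub>v n)"

definition anisotropic :: "nat \<Rightarrow> ('a :: field vec \<Rightarrow> 'a) \<Rightarrow> bool" where
  "anisotropic n q \<longleftrightarrow> (\<forall>v \<in> carrier_vec n. q v = 0 \<longrightarrow> v = 0\<^sub>v n)"

definition isometric :: "nat \<Rightarrow> ('a :: field vec \<Rightarrow> 'a) \<Rightarrow> ('a vec \<Rightarrow> 'a) \<Rightarrow> bool" where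
  "isometric n q q' \<longleftrightarrow>
     (\<exists>P \<in> carrier_mat n n. invertible_mat P \<and> (\<forall>v \<in> carrier_vec n. q' v = q (P *\<^sub>v v)))"

text \<open>The orthogonal sum of an n-dimensional and an m-dimensional form, of dimension \<open>n + m\<close>.\<close>

definition orth_sum ::
  "nat \<Rightarrow> ('a :: field vec \<Rightarrow> 'a) \<Rightarrow> nat \<Rightarrow> ('a vec \<Rightarrow> 'a) \<Rightarrow> 'a vec \<Rightarrow> 'a" where
  "orth_sum n q m q' v = q (vec_first v n) + q' (vec_last v m)"

text \<open>
  The orthogonal sum of r hyperbolic planes, of dimension \<open>2 * r\<close>; the plane is taken in the
  form \<open>XY\<close>, which is isometric to \<open>X\<^sup>2 - Y\<^sup>2\<close> in characteristic other than 2.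
\<close>

definition hyperbolic :: "nat \<Rightarrow> 'a :: field vec \<Rightarrow> 'a" where
  "hyperbolic r v = (\<Sum>i<r. v $ (2 * i) * v $ (2 * i + 1))"

text \<open>
  The Witt index is the number r of hyperbolic planes in a Witt decomposition
  \<open>q \<cong> r H \<bottom> q\<^sub>a\<^sub>n\<close> with \<open>q\<^sub>a\<^sub>n\<close> anisotropic.  For a regular form in characteristic other
  than 2, Witt's theorem says that exactly one such r exists.
\<close>

definition witt_index :: "nat \<Rightarrow> ('a :: field vec \<Rightarrow> 'a) \<Rightarrow> nat" where
  "witt_index n q = (GREATEST r. \<exists>m q_an. n = 2 * r + m \<and>
     regular_form m q_an \<and> anisotropic m q_an \<and>
     isometric n q (orth_sum (2 * r) (hyperbolic r) m q_an))"

text \<open>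
  The supremum is the maximum if the dimensions are bounded and \<open>\<infinity>\<close> otherwise; the
  set is nonempty because of the 0-dimensional form.
\<close>

definition u_invariant :: "'a :: field itself \<Rightarrow> enat" where
  "u_invariant _ = Sup {enat n | n. \<exists>q :: 'a vec \<Rightarrow> 'a. regular_form n q \<and> anisotropic n q}"

text \<open>On \<open>enat\<close> the infimum of the empty set is \<open>\<infinity>\<close>.\<close>

definition m_invariant :: "'a :: field itself \<Rightarrow> nat \<Rightarrow> nat \<Rightarrow> enat" where
  "m_invariant _ i j = Inf {enat n | n. n \<ge> 1 \<and>
     (\<exists>q :: 'a vec \<Rightarrow> 'a. regular_form n q \<and> witt_index n q < j \<and>
        (\<forall>\<sigma>. regular_form i \<sigma> \<longrightarrow> witt_index (n + i) (orth_sum n q i \<sigma>) \<ge> j))}"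

end

theory Submission
  imports Defs "Jordan_Normal_Form.Determinant"
begin

text \<open>
  The invariants \<open>m\<^sub>i\<^sub>,\<^sub>1\<close> determine \<open>u\<close> because \<open>m\<^sub>i\<^sub>,\<^sub>1 = 1\<close> holds exactly when \<open>u \<le> i\<close>.
  If \<open>u \<le> i\<close>, every form \<open>\<langle>1\<rangle> \<bottom> \<sigma>\<close> with \<open>dim \<sigma> = i\<close> is isotropic.  Conversely, an anisotropic
  form of dimension greater than \<open>i\<close> has an anisotropic subform \<open>\<langle>b\<rangle> \<bottom> \<tau>\<close> with \<open>dim \<tau> = i\<close>, and
  scaling it by \<open>a / b\<close> shows that no one-dimensional form \<open>\<langle>a\<rangle>\<close> can witness \<open>m\<^sub>i\<^sub>,\<^sub>1 = 1\<close>.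
  That isotropic forms have positive Witt index rests on the existence of a Witt decomposition.
\<close>

section \<open>Invertible matrices\<close>

lemma invertible_matI:
  assumes "A \<in> carrier_mat n n" "B \<in> carrier_mat n n" "A * B = 1\<^sub>m n" "B * A = 1\<^sub>m n"
  shows "invertible_mat A"
  using assms unfolding invertible_mat_def inverts_mat_def by auto

lemma invertible_mat_inverse:
  assumes "A \<in> carrier_mat n n" "invertible_mat A"
  shows "\<exists>B \<in> carrier_mat n n. A * B = 1\<^sub>m n \<and> B * A = 1\<^sub>m n"
proof -
  from assms(2,1) obtain B where B: "A * B = 1\<^sub>m n" "B * A = 1\<^sub>m (dim_row B)"
    unfolding invertible_mat_def inverts_mat_def by auto
  from arg_cong[OF B(1), of dim_col] arg_cong[OF B(2), of dim_col] assms(1)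
  have "B \<in> carrier_mat n n" by auto
  with B show ?thesis by auto
qed

text \<open>Over a field a trivial kernel makes the determinant nonzero and hence \<open>A\<close> a
  unit of the matrix ring. Products, block matrices and Gram blocks are shown invertible below by
  this criterion.\<close>

lemma invertible_mat_if_kernel_trivial:
  fixes A :: "'a :: field mat"
  assumes A: "A \<in> carrier_mat n n"
    and ker: "\<And>v. v \<in> carrier_vec n \<Longrightarrow> A *\<^sub>v v = 0\<^sub>v n \<Longrightarrow> v = 0\<^sub>v n"
  shows "invertible_mat A"
proof -
  have "det A \<noteq> 0" using det_0_iff_vec_prod_zero_field[OF A] ker by auto
  \<comment> \<open>The value \<open>()\<close> only fills the record extension of
    \<open>ring_mat\<close>.\<close>
  from det_non_zero_imp_unit[OF A this, of "()"] show ?thesis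
    unfolding Units_def ring_mat_def by (auto intro: invertible_matI[OF A])
qed

lemma invertible_mat_mult:
  fixes A B :: "'a :: field mat"
  assumes A: "A \<in> carrier_mat n n" "invertible_mat A" and B: "B \<in> carrier_mat n n" "invertible_mat B"
  shows "invertible_mat (A * B)"
proof -
  obtain A' where A': "A' \<in> carrier_mat n n" "A' * A = 1\<^sub>m n" using invertible_mat_inverse[OF A] by blast
  obtain B' where B': "B' \<in> carrier_mat n n" "B' * B = 1\<^sub>m n" using invertible_mat_inverse[OF B] by blast
  show ?thesis
  proof (rule invertible_mat_if_kernel_trivial)
    fix v :: "'a vec" assume v: "v \<in> carrier_vec n" and 0: "A * B *\<^sub>v v = 0\<^sub>v n"
    have "B *\<^sub>v v = (A' * A) *\<^sub>v (B *\<^sub>v v)" using A' B v by simp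
    also have "\<dots> = A' *\<^sub>v (A * B *\<^sub>v v)" using A(1) B(1) v A'(1) by simp
    also have "\<dots> = 0\<^sub>v n" unfolding 0 using A'(1) by auto
    finally have Bv: "B *\<^sub>v v = 0\<^sub>v n" .
    have "v = (B' * B) *\<^sub>v v" using B' v by simp
    also have "\<dots> = B' *\<^sub>v (B *\<^sub>v v)" using B(1) v B'(1) by simp
    also have "\<dots> = 0\<^sub>v n" unfolding Bv using B'(1) by auto
    finally show "v = 0\<^sub>v n" .
  qed (use A B in auto)
qed

section \<open>Concatenated vectors, block matrices and completion to a basis\<close>

lemma append_vec_cases:
  assumes "v \<in> carrier_vec (n + m)"
  obtains x y where "x \<in> carrier_vec n" "y \<in> carrier_vec m" "v = x @\<^sub>v y"
  using assms by (metis vec_first_carrier vec_last_carrier vec_first_last_append)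

lemma zero_append_vec [simp]: "0\<^sub>v n @\<^sub>v 0\<^sub>v m = 0\<^sub>v (n + m)"
  by (rule eq_vecI) auto

lemma append_eq_zero_vec_iff:
  fixes x y :: "'a :: zero vec"
  assumes "x \<in> carrier_vec n" "y \<in> carrier_vec m"
  shows "x @\<^sub>v y = 0\<^sub>v (n + m) \<longleftrightarrow> x = 0\<^sub>v n \<and> y = 0\<^sub>v m"
  using append_vec_eq[of x n "0\<^sub>v n" y "0\<^sub>v m"] assms by simp

lemma vec_first_append [simp]: "x \<in> carrier_vec n \<Longrightarrow> vec_first (x @\<^sub>v y) n = x"
  unfolding vec_first_def by (rule eq_vecI) auto

lemma vec_last_append [simp]: "y \<in> carrier_vec m \<Longrightarrow> vec_last (x @\<^sub>v y) m = y"
  unfolding vec_last_def by (rule eq_vecI) auto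

text \<open>Back substitution: for (x, y) in the kernel the lower rows give D y = 0, hence y = 0,
  and then the upper rows give A x = 0, hence x = 0.\<close>

lemma invertible_four_block_upper:
  fixes A :: "'a :: field mat"
  assumes A: "A \<in> carrier_mat n n" "invertible_mat A" and B: "B \<in> carrier_mat n m"
    and D: "D \<in> carrier_mat m m" "invertible_mat D"
  shows "invertible_mat (four_block_mat A B (0\<^sub>m m n) D)"
proof (rule invertible_mat_if_kernel_trivial)
  fix v assume v: "v \<in> carrier_vec (n + m)"
    and 0: "four_block_mat A B (0\<^sub>m m n) D *\<^sub>v v = 0\<^sub>v (n + m)"
  obtain x y where xy: "x \<in> carrier_vec n" "y \<in> carrier_vec m" "v = x @\<^sub>v y"
    using v by (rule append_vec_cases)
  have inj: "w = 0\<^sub>v k" if M: "M \<in> carrier_mat k k" "invertible_mat M" "w \<in> carrier_vec k" "M *\<^sub>v w = 0\<^sub>v k"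
    for M :: "'a mat" and w k
  proof -
    obtain N where N: "N \<in> carrier_mat k k" "N * M = 1\<^sub>m k" using invertible_mat_inverse[OF M(1,2)] by blast
    have "w = (N * M) *\<^sub>v w" using N M by simp
    also have "\<dots> = N *\<^sub>v (M *\<^sub>v w)" using N(1) M by simp
    finally show ?thesis using M N by auto
  qed
  have "(A *\<^sub>v x + B *\<^sub>v y) @\<^sub>v (0\<^sub>m m n *\<^sub>v x + D *\<^sub>v y) = 0\<^sub>v (n + m)"
    using four_block_mat_mult_vec[OF A(1) B _ D(1) xy(1,2), of "0\<^sub>m m n"] 0 xy by simp
  moreover have "0\<^sub>m m n *\<^sub>v x + D *\<^sub>v y = D *\<^sub>v y" using xy D by auto
  ultimately have *: "A *\<^sub>v x + B *\<^sub>v y = 0\<^sub>v n" "D *\<^sub>v y = 0\<^sub>v m"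
    using append_eq_zero_vec_iff[of "A *\<^sub>v x + B *\<^sub>v y" n "D *\<^sub>v y" m] A B D xy by auto
  have y: "y = 0\<^sub>v m" using inj[OF D xy(2) *(2)] .
  moreover have "B *\<^sub>v 0\<^sub>v m = 0\<^sub>v n" using B by (intro eq_vecI) auto
  ultimately have "A *\<^sub>v x = 0\<^sub>v n" using *(1) A B xy by auto
  with inj[OF A xy(1)] y xy(3) show "v = 0\<^sub>v (n + m)" by simp
qed (use A D in auto)

lemma if_zero_mult: "(if b then x else 0) * y = (if b then x * y else (0 :: 'a :: field))"
  by simp

text \<open>Basis exchange: \<open>v\<close> replaces a unit vector at whose coordinate it does not
  vanish. This lets an isotropic vector be moved to the first axis.\<close>

lemma ex_invertible_mat_unit_vec_0:
  fixes v :: "'a :: field vec"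
  assumes v: "v \<in> carrier_vec n" "v \<noteq> 0\<^sub>v n"
  obtains P where "P \<in> carrier_mat n n" "invertible_mat P" "P *\<^sub>v unit_vec n 0 = v"
proof -
  from v obtain k where k: "k < n" "v $ k \<noteq> 0" by (auto simp: vec_eq_iff)
  \<comment> \<open>The columns of \<open>P\<close> are \<open>v\<close> at place 0 and unit vectors
    elsewhere. The unit vector of the pivot index \<open>k\<close> is left out; if
    \<open>k \<noteq> 0\<close>, the one of index 0 moves to column \<open>k\<close>. Thus
    \<open>\<tau> i\<close> is the column of the unit entry in row
    \<open>i \<noteq> k\<close>.\<close>
  define \<tau> where "\<tau> i = (if i = 0 then k else i)" for i :: nat
  define P where "P = mat n n (\<lambda>(i, j). (if j = 0 then v $ i else 0) +
    (if j = \<tau> i then if i = k then 0 else 1 else 0))"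
  have P: "P \<in> carrier_mat n n" unfolding P_def by auto
  have Px: "(P *\<^sub>v x) $ i = v $ i * x $ 0 + (if i = k then 0 else x $ \<tau> i)"
    if "x \<in> carrier_vec n" "i < n" for x i
  proof -
    have "\<tau> i < n" using that k by (auto simp: \<tau>_def)
    have "(P *\<^sub>v x) $ i = (\<Sum>j = 0..<n. P $$ (i, j) * x $ j)"
      using that P by (simp add: scalar_prod_def)
    also have "\<dots> = (\<Sum>j = 0..<n. (if j = 0 then v $ i * x $ 0 else 0) +
        (if j = \<tau> i then if i = k then 0 else x $ \<tau> i else 0))"
      using that by (intro sum.cong) (auto simp: P_def distrib_right)
    also have "\<dots> = v $ i * x $ 0 + (if i = k then 0 else x $ \<tau> i)"
      using k \<open>\<tau> i < n\<close> by (simp add: sum.distrib sum.delta)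
    finally show ?thesis .
  qed
  have "invertible_mat P"
  proof (rule invertible_mat_if_kernel_trivial[OF P])
    fix x assume x: "x \<in> carrier_vec n" and 0: "P *\<^sub>v x = 0\<^sub>v n"
    have eq: "v $ i * x $ 0 + (if i = k then 0 else x $ \<tau> i) = 0" if "i < n" for i
      using Px[OF x that] 0 that by simp
    \<comment> \<open>The pivot row has a single nonzero entry, \<open>v $ k\<close> in column
      0.\<close>
    have x0: "x $ 0 = 0" using eq[OF k(1)] k by simp
    have "x $ j = 0" if "j < n" for j
    proof (cases "j = 0")
      case False
      \<comment> \<open>The non-pivot row whose unit entry lies in column \<open>j\<close>; with
        \<open>x $ 0 = 0\<close> its equation reads \<open>x $ j = 0\<close>.\<close>
      define i where "i = (if j = k then 0 else j)"
      have "i < n" "i \<noteq> k" "\<tau> i = j" using False that k by (auto simp: i_def \<tau>_def)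
      with eq[of i] x0 show ?thesis by simp
    qed (use x0 in simp)
    then show "x = 0\<^sub>v n" using x by auto
  qed
  moreover have "P *\<^sub>v unit_vec n 0 = v"
  proof (rule eq_vecI)
    fix i assume "i < dim_vec v"
    then have i: "i < n" using v by simp
    have "i = k \<or> \<tau> i \<noteq> 0 \<and> \<tau> i < n" using k i by (auto simp: \<tau>_def)
    then show "(P *\<^sub>v unit_vec n 0) $ i = v $ i"
      using Px[OF unit_vec_carrier i] i k by auto
  qed (use P v in auto)
  ultimately show thesis using that P by blast
qed

section \<open>Quadratic forms\<close>

lemma polar_sym: "v \<in> carrier_vec n \<Longrightarrow> w \<in> carrier_vec n \<Longrightarrow> polar q v w = polar q w v"
  unfolding polar_def using comm_add_vec[of v n w] by simp

lemma quadratic_form_smult: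
  "quadratic_form n q \<Longrightarrow> v \<in> carrier_vec n \<Longrightarrow> q (c \<cdot>\<^sub>v v) = c\<^sup>2 * q v"
  unfolding quadratic_form_def by blast

lemma polar_add_left:
  "quadratic_form n q \<Longrightarrow> u \<in> carrier_vec n \<Longrightarrow> v \<in> carrier_vec n \<Longrightarrow> w \<in> carrier_vec n \<Longrightarrow>
    polar q (u + v) w = polar q u w + polar q v w"
  unfolding quadratic_form_def by blast

lemma polar_smult_left:
  "quadratic_form n q \<Longrightarrow> v \<in> carrier_vec n \<Longrightarrow> w \<in> carrier_vec n \<Longrightarrow>
    polar q (c \<cdot>\<^sub>v v) w = c * polar q v w"
  unfolding quadratic_form_def by blast

lemma polar_add_right:
  assumes "quadratic_form n q" "u \<in> carrier_vec n" "v \<in> carrier_vec n" "w \<in> carrier_vec n"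
  shows "polar q w (u + v) = polar q w u + polar q w v"
  using assms polar_add_left[OF assms] polar_sym[of w n] by auto

lemma polar_smult_right:
  assumes "quadratic_form n q" "v \<in> carrier_vec n" "w \<in> carrier_vec n"
  shows "polar q w (c \<cdot>\<^sub>v v) = c * polar q w v"
  using assms polar_smult_left[OF assms] polar_sym[of w n] by auto

lemma quadratic_form_zero:
  assumes "quadratic_form n (q :: 'a :: field vec \<Rightarrow> 'a)"
  shows "q (0\<^sub>v n) = 0"
proof -
  have "0 \<cdot>\<^sub>v 0\<^sub>v n = (0\<^sub>v n :: 'a vec)" by auto
  then show ?thesis using quadratic_form_smult[OF assms, of "0\<^sub>v n" 0] by simp
qed

lemma quadratic_form_add: "q (v + w) = q v + q w + polar q v w"
  by (simp add: polar_def)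

lemma polar_self:
  assumes "quadratic_form n q" "v \<in> carrier_vec n"
  shows "polar q v v = 2 * q v"
proof -
  have "v + v = 2 \<cdot>\<^sub>v v" using assms by (intro eq_vecI) auto
  then show ?thesis unfolding polar_def by (simp add: quadratic_form_smult[OF assms])
qed

section \<open>Linear functionals and Gram matrices\<close>

lemma linear_functional_expand:
  fixes f :: "'a :: field vec \<Rightarrow> 'a"
  assumes add: "\<And>u v. u \<in> carrier_vec n \<Longrightarrow> v \<in> carrier_vec n \<Longrightarrow> f (u + v) = f u + f v"
    and smult: "\<And>c v. v \<in> carrier_vec n \<Longrightarrow> f (c \<cdot>\<^sub>v v) = c * f v"
    and v: "v \<in> carrier_vec n"
  shows "f v = v \<bullet> vec n (\<lambda>i. f (unit_vec n i))"
proof -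
  \<comment> \<open>Induction on the number of coordinates kept: each step adds a multiple of one
    unit vector to the truncation of \<open>v\<close>.\<close>
  have partial: "f (vec n (\<lambda>i. if i < k then v $ i else 0)) = (\<Sum>i<k. v $ i * f (unit_vec n i))" if "k \<le> n" for k
    using that
  proof (induction k)
    case 0
    \<comment> \<open>Writing the zero vector as a multiple by 0 lets homogeneity give the value
      0.\<close>
    have "vec n (\<lambda>i. if i < 0 then v $ i else 0) = 0 \<cdot>\<^sub>v v" using v by auto
    then show ?case using smult[OF v, of 0] by simp
  next
    case (Suc k)
    have "vec n (\<lambda>i. if i < Suc k then v $ i else 0) =
        vec n (\<lambda>i. if i < k then v $ i else 0) + v $ k \<cdot>\<^sub>v unit_vec n k"
      using Suc.prems by (intro eq_vecI) (auto simp: less_Suc_eq)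
    then show ?case using Suc by (simp add: add smult)
  qed
  have "vec n (\<lambda>i. if i < n then v $ i else 0) = v" using v by auto
  with partial[of n] have "f v = (\<Sum>i<n. v $ i * f (unit_vec n i))" by simp
  then show ?thesis by (simp add: scalar_prod_def lessThan_atLeast0)
qed

text \<open>The matrix is the Gram matrix in the standard basis. It appears by expanding the left
  argument first and then, row by row, the right one.\<close>

lemma polar_gram:
  assumes q: "quadratic_form n q" and v: "v \<in> carrier_vec n" and w: "w \<in> carrier_vec n"
  shows "polar q v w = v \<bullet> (mat n n (\<lambda>(i, j). polar q (unit_vec n i) (unit_vec n j)) *\<^sub>v w)"
proof -
  let ?G = "mat n n (\<lambda>(i, j). polar q (unit_vec n i) (unit_vec n j))"
  have "polar q v w = v \<bullet> vec n (\<lambda>i. polar q (unit_vec n i) w)"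
    by (rule linear_functional_expand[of n "\<lambda>v. polar q v w"])
      (use q v w in \<open>auto simp: polar_add_left polar_smult_left\<close>)
  also have "vec n (\<lambda>i. polar q (unit_vec n i) w) = ?G *\<^sub>v w"
  proof (rule eq_vecI)
    fix i assume "i < dim_vec (?G *\<^sub>v w)"
    then have i: "i < n" by simp
    have "polar q (unit_vec n i) w = w \<bullet> vec n (\<lambda>j. polar q (unit_vec n i) (unit_vec n j))"
      by (rule linear_functional_expand[of n "\<lambda>w. polar q (unit_vec n i) w"])
        (use q w in \<open>auto simp: polar_add_right[of n] polar_smult_right[of n]\<close>)
    also have "\<dots> = (?G *\<^sub>v w) $ i"
      using i w by (auto simp: scalar_prod_def mult.commute intro!: sum.cong)
    finally show "vec n (\<lambda>i. polar q (unit_vec n i) w) $ i = (?G *\<^sub>v w) $ i" using i by simp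
  qed simp
  finally show ?thesis .
qed

section \<open>Change of coordinates and isometry\<close>

lemma polar_mult_mat_vec:
  fixes P :: "'a :: field mat"
  assumes "P \<in> carrier_mat n m" "v \<in> carrier_vec m" "w \<in> carrier_vec m"
  shows "polar (\<lambda>v. q (P *\<^sub>v v)) v w = polar q (P *\<^sub>v v) (P *\<^sub>v w)"
  using assms unfolding polar_def by (simp add: mult_add_distrib_mat_vec[OF assms])

lemma quadratic_form_mult_mat_vec:
  fixes P :: "'a :: field mat"
  assumes q: "quadratic_form n q" and P: "P \<in> carrier_mat n m"
  shows "quadratic_form m (\<lambda>v. q (P *\<^sub>v v))"
  unfolding quadratic_form_def
proof (intro conjI allI ballI)
  have c: "P *\<^sub>v v \<in> carrier_vec n" for v using P by (auto intro: carrier_vecI)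
  show "q (P *\<^sub>v (c \<cdot>\<^sub>v v)) = c\<^sup>2 * q (P *\<^sub>v v)" if "v \<in> carrier_vec m" for c v
    using that by (simp add: mult_mat_vec[OF P] quadratic_form_smult[OF q c])
  show "polar (\<lambda>v. q (P *\<^sub>v v)) (u + v) w =
      polar (\<lambda>v. q (P *\<^sub>v v)) u w + polar (\<lambda>v. q (P *\<^sub>v v)) v w"
    if "u \<in> carrier_vec m" "v \<in> carrier_vec m" "w \<in> carrier_vec m" for u v w
    using that by (simp add: polar_mult_mat_vec[OF P] mult_add_distrib_mat_vec[OF P] polar_add_left[OF q] c)
  show "polar (\<lambda>v. q (P *\<^sub>v v)) (c \<cdot>\<^sub>v v) w = c * polar (\<lambda>v. q (P *\<^sub>v v)) v w"
    if "v \<in> carrier_vec m" "w \<in> carrier_vec m" for c v w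
    using that by (simp add: polar_mult_mat_vec[OF P] mult_mat_vec[OF P] polar_smult_left[OF q] c)
qed

text \<open>Every \<open>w\<close> has the form P (B w), so \<open>P\<close> sends a radical vector
  of the pulled-back form to a radical vector of \<open>q\<close>.\<close>

lemma regular_form_mult_mat_vec:
  fixes P :: "'a :: field mat"
  assumes q: "regular_form n q" and P: "P \<in> carrier_mat n n" "invertible_mat P"
  shows "regular_form n (\<lambda>v. q (P *\<^sub>v v))"
  unfolding regular_form_def
proof (intro conjI ballI impI)
  show "quadratic_form n (\<lambda>v. q (P *\<^sub>v v))"
    using q P quadratic_form_mult_mat_vec unfolding regular_form_def by blast
  obtain B where B: "B \<in> carrier_mat n n" "P * B = 1\<^sub>m n" "B * P = 1\<^sub>m n"
    using invertible_mat_inverse[OF P(1,2)] by blast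
  fix v assume v: "v \<in> carrier_vec n"
    and 0: "\<forall>w\<in>carrier_vec n. polar (\<lambda>v. q (P *\<^sub>v v)) v w = 0"
  have "polar q (P *\<^sub>v v) w = 0" if w: "w \<in> carrier_vec n" for w
  proof -
    have "P *\<^sub>v (B *\<^sub>v w) = w" using P B w by (metis assoc_mult_mat_vec one_mult_mat_vec)
    with 0 polar_mult_mat_vec[OF P(1) v, of "B *\<^sub>v w" q] B w show ?thesis by auto
  qed
  then have "P *\<^sub>v v = 0\<^sub>v n" using q P v unfolding regular_form_def by auto
  then have "B *\<^sub>v (P *\<^sub>v v) = 0\<^sub>v n" using B(1) by auto
  then show "v = 0\<^sub>v n" using P B v by (metis assoc_mult_mat_vec one_mult_mat_vec)
qed

text \<open>A radical vector is orthogonal to itself, so \<open>2 * q v = 0\<close>. The assumption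
  on the characteristic enters here.\<close>

lemma anisotropic_imp_regular:
  assumes "(2 :: 'a :: field) \<noteq> 0" "quadratic_form n q" "anisotropic n (q :: 'a vec \<Rightarrow> 'a)"
  shows "regular_form n q"
  unfolding regular_form_def
proof (intro conjI ballI impI)
  fix v :: "'a vec" assume "v \<in> carrier_vec n" "\<forall>w\<in>carrier_vec n. polar q v w = 0"
  with assms polar_self[OF assms(2), of v] show "v = 0\<^sub>v n" by (auto simp: anisotropic_def)
qed (rule assms)

lemma isometric_refl: "isometric n q q"
  unfolding isometric_def
  by (rule bexI[of _ "1\<^sub>m n"]) (auto intro: invertible_matI[of _ n "1\<^sub>m n"])

lemma isometric_cong:
  assumes "isometric n q q'" "\<And>v. v \<in> carrier_vec n \<Longrightarrow> q' v = q'' v"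
  shows "isometric n q q''"
  using assms unfolding isometric_def by auto

lemma isometric_trans:
  assumes "isometric n q q'" "isometric n q' q''"
  shows "isometric n q q''"
proof -
  from assms obtain P R where
    P: "P \<in> carrier_mat n n" "invertible_mat P" "\<And>v. v \<in> carrier_vec n \<Longrightarrow> q' v = q (P *\<^sub>v v)" and
    R: "R \<in> carrier_mat n n" "invertible_mat R" "\<And>v. v \<in> carrier_vec n \<Longrightarrow> q'' v = q' (R *\<^sub>v v)"
    unfolding isometric_def by metis
  show ?thesis unfolding isometric_def
    using P R by (intro bexI[of _ "P * R"]) (auto simp: invertible_mat_mult)
qed

lemma isometric_anisotropic:
  assumes q: "isometric n q q'" "anisotropic n q"
  shows "anisotropic n q'"
  unfolding anisotropic_def
proof (intro ballI impI)
  fix v assume v: "v \<in> carrier_vec n" "q' v = 0"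
  from q obtain P where P: "P \<in> carrier_mat n n" "invertible_mat P" "q' v = q (P *\<^sub>v v)"
    using v unfolding isometric_def by blast
  have "P *\<^sub>v v = 0\<^sub>v n" using q(2) P v unfolding anisotropic_def by auto
  moreover obtain B where B: "B \<in> carrier_mat n n" "B * P = 1\<^sub>m n" using invertible_mat_inverse[OF P(1,2)] by blast
  ultimately have "B *\<^sub>v (P *\<^sub>v v) = 0\<^sub>v n" by auto
  then show "v = 0\<^sub>v n" using P B v by (metis assoc_mult_mat_vec one_mult_mat_vec)
qed

section \<open>Orthogonal sums\<close>

lemma orth_sum_append [simp]:
  "x \<in> carrier_vec n \<Longrightarrow> y \<in> carrier_vec m \<Longrightarrow> orth_sum n q m q' (x @\<^sub>v y) = q x + q' y"
  by (simp add: orth_sum_def)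

lemma polar_orth_sum:
  assumes "x \<in> carrier_vec n" "x' \<in> carrier_vec n" "y \<in> carrier_vec m" "y' \<in> carrier_vec m"
  shows "polar (orth_sum n q m q') (x @\<^sub>v y) (x' @\<^sub>v y') = polar q x x' + polar q' y y'"
  using assms unfolding polar_def by (simp add: append_vec_add[of _ n _ _ m])

lemma smult_append_vec: "c \<cdot>\<^sub>v (x @\<^sub>v y) = (c \<cdot>\<^sub>v x) @\<^sub>v (c \<cdot>\<^sub>v y)"
  by (rule eq_vecI) auto

lemma regular_form_orth_sum:
  assumes "regular_form n q" "regular_form m q'"
  shows "regular_form (n + m) (orth_sum n q m q')"
proof -
  have q: "quadratic_form n q" and q': "quadratic_form m q'" using assms unfolding regular_form_def by auto
  show ?thesis
    unfolding regular_form_def quadratic_form_def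
  proof (intro conjI allI ballI impI)
    let ?s = "orth_sum n q m q'"
    show "?s (c \<cdot>\<^sub>v v) = c\<^sup>2 * ?s v" if "v \<in> carrier_vec (n + m)" for c v
      using that
      by (auto elim!: append_vec_cases simp: smult_append_vec quadratic_form_smult[OF q]
          quadratic_form_smult[OF q'] distrib_left)
    show "polar ?s (u + v) w = polar ?s u w + polar ?s v w"
      if "u \<in> carrier_vec (n + m)" "v \<in> carrier_vec (n + m)" "w \<in> carrier_vec (n + m)" for u v w
      using that
      by (auto elim!: append_vec_cases simp: append_vec_add polar_orth_sum polar_add_left[OF q]
          polar_add_left[OF q'])
    show "polar ?s (c \<cdot>\<^sub>v v) w = c * polar ?s v w"
      if "v \<in> carrier_vec (n + m)" "w \<in> carrier_vec (n + m)" for c v w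
      using that
      by (auto elim!: append_vec_cases simp: smult_append_vec polar_orth_sum polar_smult_left[OF q]
          polar_smult_left[OF q'] distrib_left)
  next
    fix v assume v: "v \<in> carrier_vec (n + m)"
      and 0: "\<forall>w\<in>carrier_vec (n + m). polar (orth_sum n q m q') v w = 0"
    obtain x y where xy: "x \<in> carrier_vec n" "y \<in> carrier_vec m" "v = x @\<^sub>v y"
      using v by (rule append_vec_cases)
    have *: "polar q x x' + polar q' y y' = 0" if "x' \<in> carrier_vec n" "y' \<in> carrier_vec m" for x' y'
      using 0[rule_format, of "x' @\<^sub>v y'"] that xy by (simp add: polar_orth_sum)
    \<comment> \<open>Pairing with the zero vector vanishes, so testing against (x', 0) and (0, y')
      separates the two summands.\<close>
    have "polar q x (0\<^sub>v n) = 0" "polar q' y (0\<^sub>v m) = 0"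
      using xy quadratic_form_zero[OF q] quadratic_form_zero[OF q'] by (auto simp: polar_def)
    then have "x = 0\<^sub>v n" "y = 0\<^sub>v m"
      using assms xy *[of _ "0\<^sub>v m"] *[of "0\<^sub>v n"] unfolding regular_form_def by auto
    then show "v = 0\<^sub>v (n + m)" using xy by simp
  qed
qed

text \<open>The base change is block diagonal: the identity on the first summand, the given isometry
  on the second.\<close>

lemma isometric_orth_sum_right:
  fixes q :: "'a :: field vec \<Rightarrow> 'a"
  assumes "isometric m q' q''"
  shows "isometric (n + m) (orth_sum n q m q') (orth_sum n q m q'')"
proof -
  from assms obtain P where P: "P \<in> carrier_mat m m" "invertible_mat P"
    "\<And>v. v \<in> carrier_vec m \<Longrightarrow> q'' v = q' (P *\<^sub>v v)" unfolding isometric_def by metis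
  have "invertible_mat (1\<^sub>m n :: 'a mat)" by (auto intro: invertible_matI[of _ n "1\<^sub>m n"])
  then have inv: "invertible_mat (four_block_mat (1\<^sub>m n) (0\<^sub>m n m) (0\<^sub>m m n) P)"
    by (intro invertible_four_block_upper) (use P in auto)
  have "orth_sum n q m q'' v = orth_sum n q m q' (four_block_mat (1\<^sub>m n) (0\<^sub>m n m) (0\<^sub>m m n) P *\<^sub>v v)"
    if "v \<in> carrier_vec (n + m)" for v
    using that
  proof (rule append_vec_cases)
    fix x y assume "x \<in> carrier_vec n" "y \<in> carrier_vec m" "v = x @\<^sub>v y"
    then show ?thesis using P by (simp add: mult_mat_vec_split[of _ n _ m])
  qed
  with inv P show ?thesis unfolding isometric_def by (intro bexI) auto
qed

lemma orth_sum_assoc: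
  assumes "v \<in> carrier_vec (l + (n + m))"
  shows "orth_sum l p (n + m) (orth_sum n q m q') v = orth_sum (l + n) (orth_sum l p n q) m q' v"
proof -
  obtain x z where z: "x \<in> carrier_vec l" "z \<in> carrier_vec (n + m)" "v = x @\<^sub>v z"
    using assms by (rule append_vec_cases)
  obtain y w where w: "y \<in> carrier_vec n" "w \<in> carrier_vec m" "z = y @\<^sub>v w"
    using z(2) by (rule append_vec_cases)
  have v: "v = (x @\<^sub>v y) @\<^sub>v w" unfolding z w by (rule eq_vecI) (use z w in auto)
  have "orth_sum l p (n + m) (orth_sum n q m q') v = p x + (q y + q' w)"
    unfolding z(3) w(3) using z(1) w(1,2) by simp
  moreover have "orth_sum (l + n) (orth_sum l p n q) m q' v = p x + q y + q' w"
    unfolding v using z(1) w(1,2) by simp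
  ultimately show ?thesis by (simp add: add.assoc)
qed

section \<open>Restriction to a coordinate subspace and its orthogonal complement\<close>

lemma append_zero_eq_mult:
  fixes x :: "'a :: field vec"
  assumes "x \<in> carrier_vec n"
  shows "x @\<^sub>v 0\<^sub>v m = mat (n + m) n (\<lambda>(i, j). if i = j then 1 else 0) *\<^sub>v x"
proof (rule eq_vecI)
  fix i assume i: "i < dim_vec (mat (n + m) n (\<lambda>(i, j). if i = j then (1 :: 'a) else 0) *\<^sub>v x)"
  have "(mat (n + m) n (\<lambda>(i, j). if i = j then 1 else 0) *\<^sub>v x) $ i =
      (\<Sum>j = 0..<n. if i = j then x $ i else 0)"
    using i assms by (simp add: scalar_prod_def if_zero_mult)
  then show "(x @\<^sub>v 0\<^sub>v m) $ i = (mat (n + m) n (\<lambda>(i, j). if i = j then 1 else 0) *\<^sub>v x) $ i"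
    using i assms by simp
qed (use assms in auto)

lemma quadratic_form_cong:
  assumes "quadratic_form n q" "\<And>v. v \<in> carrier_vec n \<Longrightarrow> q v = q' v"
  shows "quadratic_form n q'"
proof -
  have "polar q' v w = polar q v w" if "v \<in> carrier_vec n" "w \<in> carrier_vec n" for v w
    using that assms(2) unfolding polar_def by simp
  with assms show ?thesis unfolding quadratic_form_def by simp
qed

text \<open>The inclusion of x as (x, 0) is multiplication by a rectangular identity matrix, so
  restricting is a special case of pulling back.\<close>

lemma quadratic_form_restrict:
  assumes "quadratic_form (n + m) q"
  shows "quadratic_form n (\<lambda>x. q (x @\<^sub>v 0\<^sub>v m))"
  by (rule quadratic_form_cong[OF quadratic_form_mult_mat_vec[OF assms]])
    (auto simp: append_zero_eq_mult)

text \<open>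
  With Gram matrix \<open>((A, B), (B\<^sup>T, D))\<close>, regularity of the restriction makes \<open>A\<close> invertible, and
  \<open>y \<mapsto> (- A\<inverse> B y, y)\<close> parametrizes the orthogonal complement.
\<close>

lemma split_regular_restriction:
  fixes q :: "'a :: field vec \<Rightarrow> 'a"
  assumes q: "regular_form (n + m) q" and r: "regular_form n (\<lambda>x. q (x @\<^sub>v 0\<^sub>v m))"
  obtains q' where "regular_form m q'"
    "isometric (n + m) q (orth_sum n (\<lambda>x. q (x @\<^sub>v 0\<^sub>v m)) m q')"
proof -
  let ?r = "\<lambda>x. q (x @\<^sub>v 0\<^sub>v m)"
  have qf: "quadratic_form (n + m) q" using q unfolding regular_form_def by blast
  define G where "G = mat (n + m) (n + m) (\<lambda>(i, j). polar q (unit_vec (n + m) i) (unit_vec (n + m) j))"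
  obtain A B C D where "split_block G n n = (A, B, C, D)" by (metis prod_cases4)
  from split_block[OF this, of m m] have G: "A \<in> carrier_mat n n" "B \<in> carrier_mat n m"
    "C \<in> carrier_mat m n" "D \<in> carrier_mat m m" "G = four_block_mat A B C D"
    by (auto simp: G_def)
  \<comment> \<open>Pairing with a vector of the first summand involves only the upper blocks of the
    Gram matrix.\<close>
  have pol: "polar q (x @\<^sub>v 0\<^sub>v m) (x' @\<^sub>v y) = x \<bullet> (A *\<^sub>v x' + B *\<^sub>v y)"
    if x: "x \<in> carrier_vec n" and x': "x' \<in> carrier_vec n" and y: "y \<in> carrier_vec m" for x x' y
  proof -
    have "polar q (x @\<^sub>v 0\<^sub>v m) (x' @\<^sub>v y) = (x @\<^sub>v 0\<^sub>v m) \<bullet> (G *\<^sub>v (x' @\<^sub>v y))"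
      unfolding G_def using that by (intro polar_gram[OF qf]) auto
    also have "G *\<^sub>v (x' @\<^sub>v y) = (A *\<^sub>v x' + B *\<^sub>v y) @\<^sub>v (C *\<^sub>v x' + D *\<^sub>v y)"
      unfolding G(5) by (rule four_block_mat_mult_vec[OF G(1-4) x' y])
    also have "(x @\<^sub>v 0\<^sub>v m) \<bullet> \<dots> = x \<bullet> (A *\<^sub>v x' + B *\<^sub>v y)"
      by (subst scalar_prod_append[of _ n _ m]) (use that G in auto)
    finally show ?thesis .
  qed
  \<comment> \<open>\<open>A\<close> is the Gram matrix of \<open>?r\<close>, so its kernel lies in
    the radical of \<open>?r\<close>.\<close>
  have "invertible_mat A"
  proof (rule invertible_mat_if_kernel_trivial[OF G(1)])
    fix v assume v: "v \<in> carrier_vec n" and 0: "A *\<^sub>v v = 0\<^sub>v n"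
    have "polar ?r v w = 0" if w: "w \<in> carrier_vec n" for w
    proof -
      have "polar ?r v w = polar ?r w v" by (rule polar_sym[OF v w])
      also have "\<dots> = polar q (w @\<^sub>v 0\<^sub>v m) (v @\<^sub>v 0\<^sub>v m)"
        unfolding polar_def by (simp add: append_vec_add[OF w v, of _ m])
      also have "B *\<^sub>v 0\<^sub>v m = 0\<^sub>v n" using G(2) by (intro eq_vecI) auto
      then have "polar q (w @\<^sub>v 0\<^sub>v m) (v @\<^sub>v 0\<^sub>v m) = 0" using pol[OF w v, of "0\<^sub>v m"] 0 w by simp
      finally show ?thesis .
    qed
    then show "v = 0\<^sub>v n" using r v unfolding regular_form_def by blast
  qed
  then obtain A' where A': "A' \<in> carrier_mat n n" "A * A' = 1\<^sub>m n" using invertible_mat_inverse[OF G(1)] by blast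
  define T where "T = - (A' * B)"
  have T: "T \<in> carrier_mat n m" unfolding T_def using A' G by auto
  \<comment> \<open>By \<open>pol\<close>, this says that (T y, y) is orthogonal to every (x,
    0).\<close>
  have AT: "A *\<^sub>v (T *\<^sub>v y) + B *\<^sub>v y = 0\<^sub>v n" if y: "y \<in> carrier_vec m" for y
  proof -
    have "A * (A' * B) = B" using assoc_mult_mat[OF G(1) A'(1) G(2)] A'(2) G(2) by simp
    then have "A * T = - B" unfolding T_def using A' G by simp
    then have "A *\<^sub>v (T *\<^sub>v y) = - B *\<^sub>v y"
      using assoc_mult_mat_vec[OF G(1) T y] by simp
    then show ?thesis using G y by auto
  qed
  \<comment> \<open>The shear taking (x, y) to (x + T y, y): it fixes the first summand and carries
    the second onto the orthogonal complement.\<close>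
  define P where "P = four_block_mat (1\<^sub>m n) T (0\<^sub>m m n) (1\<^sub>m m)"
  have one: "invertible_mat (1\<^sub>m k :: 'a mat)" for k by (auto intro: invertible_matI[of _ k "1\<^sub>m k"])
  have P: "P \<in> carrier_mat (n + m) (n + m)" "invertible_mat P"
    unfolding P_def using invertible_four_block_upper[OF one_carrier_mat one T one_carrier_mat one]
    by auto
  define q' where "q' y = q ((T *\<^sub>v y) @\<^sub>v y)" for y
  have sum: "q (P *\<^sub>v v) = orth_sum n ?r m q' v" if "v \<in> carrier_vec (n + m)" for v
    using that
  proof (rule append_vec_cases)
    fix x y assume xy: "x \<in> carrier_vec n" "y \<in> carrier_vec m" "v = x @\<^sub>v y"
    have "P *\<^sub>v v = (x + T *\<^sub>v y) @\<^sub>v y"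
      unfolding P_def xy(3) by (subst four_block_mat_mult_vec[OF _ T _ _ xy(1,2)]) (use xy in auto)
    also have "\<dots> = (x @\<^sub>v 0\<^sub>v m) + ((T *\<^sub>v y) @\<^sub>v y)"
      by (subst append_vec_add[of _ n _ _ m]) (use xy T in auto)
    also have "q \<dots> = ?r x + q' y + polar q (x @\<^sub>v 0\<^sub>v m) ((T *\<^sub>v y) @\<^sub>v y)"
      unfolding q'_def by (rule quadratic_form_add)
    also have "polar q (x @\<^sub>v 0\<^sub>v m) ((T *\<^sub>v y) @\<^sub>v y) = 0"
      using pol[OF xy(1) _ xy(2)] AT[OF xy(2)] T xy by auto
    finally show ?thesis using xy by simp
  qed
  have iso: "isometric (n + m) q (orth_sum n ?r m q')"
    unfolding isometric_def using P sum by (intro bexI[of _ P]) auto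
  have regP: "regular_form (n + m) (\<lambda>v. q (P *\<^sub>v v))" using regular_form_mult_mat_vec[OF q P] .
  \<comment> \<open>This presents \<open>q'\<close> as the restriction of the regular form q(P v) to
    the vectors (0, y), from which its axioms are inherited.\<close>
  have q'0: "q' y = q (P *\<^sub>v (0\<^sub>v n @\<^sub>v y))" if "y \<in> carrier_vec m" for y
    using sum[of "0\<^sub>v n @\<^sub>v y"] that quadratic_form_zero[OF qf] by simp
  \<comment> \<open>The first component of the right argument does not affect the pairing. Hence y
    in the radical of \<open>q'\<close> makes (0, y) radical for q(P v), which is regular.\<close>
  have polP: "polar (\<lambda>v. q (P *\<^sub>v v)) (0\<^sub>v n @\<^sub>v y) (x @\<^sub>v z) = polar q' y z"
    if "x \<in> carrier_vec n" "y \<in> carrier_vec m" "z \<in> carrier_vec m" for x y z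
  proof -
    have "polar (\<lambda>v. q (P *\<^sub>v v)) (0\<^sub>v n @\<^sub>v y) (x @\<^sub>v z) =
        polar (orth_sum n ?r m q') (0\<^sub>v n @\<^sub>v y) (x @\<^sub>v z)"
      using that by (simp add: polar_def sum)
    also have "\<dots> = polar q' y z"
      using that quadratic_form_zero[OF qf] by (simp add: polar_orth_sum) (simp add: polar_def)
    finally show ?thesis .
  qed
  have "regular_form m q'"
    unfolding regular_form_def quadratic_form_def
  proof (intro conjI allI ballI impI)
    have f: "quadratic_form (n + m) (\<lambda>v. q (P *\<^sub>v v))" using regP unfolding regular_form_def by blast
    have z: "c \<cdot>\<^sub>v (0\<^sub>v n @\<^sub>v v) = 0\<^sub>v n @\<^sub>v c \<cdot>\<^sub>v v" for c :: 'a and v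
      by (rule eq_vecI) auto
    show "q' (c \<cdot>\<^sub>v v) = c\<^sup>2 * q' v" if "v \<in> carrier_vec m" for c v
      using that quadratic_form_smult[OF f, of "0\<^sub>v n @\<^sub>v v" c] by (simp add: q'0 flip: z)
    show "polar q' (c \<cdot>\<^sub>v v) w = c * polar q' v w" if "v \<in> carrier_vec m" "w \<in> carrier_vec m" for c v w
      using that polar_smult_left[OF f, of "0\<^sub>v n @\<^sub>v v" "0\<^sub>v n @\<^sub>v w" c]
      by (simp add: polP z)
    show "polar q' (u + v) w = polar q' u w + polar q' v w"
      if "u \<in> carrier_vec m" "v \<in> carrier_vec m" "w \<in> carrier_vec m" for u v w
      using that polar_add_left[OF f, of "0\<^sub>v n @\<^sub>v u" "0\<^sub>v n @\<^sub>v v" "0\<^sub>v n @\<^sub>v w"]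
      by (simp add: polP append_vec_add[of _ n _ _ m])
  next
    fix y assume y: "y \<in> carrier_vec m" and 0: "\<forall>w\<in>carrier_vec m. polar q' y w = 0"
    have "polar (\<lambda>v. q (P *\<^sub>v v)) (0\<^sub>v n @\<^sub>v y) w = 0" if "w \<in> carrier_vec (n + m)" for w
      using that by (rule append_vec_cases) (use y 0 in \<open>simp add: polP\<close>)
    then have "0\<^sub>v n @\<^sub>v y = 0\<^sub>v (n + m)" using regP y unfolding regular_form_def by auto
    then show "y = 0\<^sub>v m" using y append_eq_zero_vec_iff[of "0\<^sub>v n" n y m] by auto
  qed
  with iso that show thesis by blast
qed

section \<open>Witt decomposition\<close>

lemma hyperbolic_plane:
  fixes r :: "'a :: field vec \<Rightarrow> 'a"
  assumes r: "quadratic_form 2 r" and r0: "r (unit_vec 2 0) = 0" and r1: "r (unit_vec 2 1) = 0"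
    and r01: "polar r (unit_vec 2 0) (unit_vec 2 1) = 1"
  shows "regular_form 2 r" "x \<in> carrier_vec 2 \<Longrightarrow> r x = hyperbolic 1 x"
proof -
  have p: "polar r (unit_vec 2 0) (unit_vec 2 0) = 0" "polar r (unit_vec 2 1) (unit_vec 2 1) = 0"
    using polar_self[OF r, of "unit_vec 2 0"] polar_self[OF r, of "unit_vec 2 1"] r0 r1 by auto
  have p10: "polar r (unit_vec 2 1) (unit_vec 2 0) = 1"
    using r01 by (metis polar_sym unit_vec_carrier)
  have x: "x = x $ 0 \<cdot>\<^sub>v unit_vec 2 0 + x $ 1 \<cdot>\<^sub>v unit_vec 2 1" if "x \<in> carrier_vec 2" for x :: "'a vec"
    using that by (intro eq_vecI) (auto simp: less_2_cases_iff)
  show "r x = hyperbolic 1 x" if "x \<in> carrier_vec 2"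
    by (subst x[OF that])
      (simp add: quadratic_form_add quadratic_form_smult[OF r] polar_smult_left[OF r]
        polar_smult_right[OF r] hyperbolic_def r0 r1[simplified] r01[simplified])
  show "regular_form 2 r"
    unfolding regular_form_def
  proof (intro conjI ballI impI r)
    fix v :: "'a vec" assume v: "v \<in> carrier_vec 2" and 0: "\<forall>w\<in>carrier_vec 2. polar r v w = 0"
    \<comment> \<open>Pairing with one basis vector reads off the coordinate of \<open>v\<close>
      along the other.\<close>
    have pv: "polar r v w = v $ 0 * polar r (unit_vec 2 0) w + v $ 1 * polar r (unit_vec 2 1) w"
      if "w \<in> carrier_vec 2" for w
      using that
      by (subst x[OF v]) (simp add: polar_add_left[OF r] polar_smult_left[OF r])
    have "v $ 0 = 0" using 0[rule_format, of "unit_vec 2 1"] pv[of "unit_vec 2 1"]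
      unfolding p r01 by simp
    moreover have "v $ 1 = 0" using 0[rule_format, of "unit_vec 2 0"] pv[of "unit_vec 2 0"]
      unfolding p p10 by simp
    ultimately have "v $ 0 = 0" "v $ 1 = 0" .
    with v show "v = 0\<^sub>v 2" by (intro eq_vecI) (auto simp: less_2_cases_iff)
  qed
qed

lemma mult_mat_zero_vec: "A \<in> carrier_mat n m \<Longrightarrow> A *\<^sub>v 0\<^sub>v m = (0\<^sub>v n :: 'a :: field vec)"
  by (intro eq_vecI) auto

lemma unit_vec_append_zero: "i < n \<Longrightarrow> unit_vec n i @\<^sub>v 0\<^sub>v m = unit_vec (n + m) i"
  by (intro eq_vecI) auto

lemma zero_append_unit_vec: "i < m \<Longrightarrow> 0\<^sub>v n @\<^sub>v unit_vec m i = unit_vec (n + m) (n + i)"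
  by (intro eq_vecI) auto

text \<open>The isotropic vector is completed to a hyperbolic pair, the pair is moved to the first
  two axes, and its span, being regular, splits off.\<close>

lemma split_hyperbolic_plane_unit_vec:
  fixes q :: "'a :: field vec \<Rightarrow> 'a"
  assumes q: "regular_form (1 + k) q" and q0: "q (unit_vec (1 + k) 0) = 0"
  obtains m q' where "k = 1 + m" "regular_form m q'"
    "isometric (2 + m) q (orth_sum 2 (hyperbolic 1) m q')"
proof -
  have qf: "quadratic_form (1 + k) q" using q unfolding regular_form_def by blast
  define e :: "'a vec" where "e = unit_vec (1 + k) 0"
  have e: "e \<in> carrier_vec (1 + k)" "e \<noteq> 0\<^sub>v (1 + k)" "q e = 0"
    using q0 unfolding e_def by auto
  have ee: "polar q e e = 0" using polar_self[OF qf e(1)] e(3) by simp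
  \<comment> \<open>Regularity gives a partner that is not orthogonal to \<open>e\<close>; it is
    then scaled to have pairing 1.\<close>
  from q e obtain w0 where w0: "w0 \<in> carrier_vec (1 + k)" "polar q e w0 \<noteq> 0"
    unfolding regular_form_def by blast
  define w1 where "w1 = inverse (polar q e w0) \<cdot>\<^sub>v w0"
  have w1: "w1 \<in> carrier_vec (1 + k)" "polar q e w1 = 1"
    unfolding w1_def using w0 e by (auto simp: polar_smult_right[OF qf])
  \<comment> \<open>Since \<open>e\<close> is isotropic and pairs to 1 with \<open>w1\<close>,
    adding c times \<open>e\<close> changes the value at \<open>w1\<close> by c and keeps the
    pairing with \<open>e\<close>. The choice c = - q(w1) makes the partner isotropic.\<close>
  define w where "w = w1 + (- q w1) \<cdot>\<^sub>v e"
  have w: "w \<in> carrier_vec (1 + k)" unfolding w_def using w1 e by auto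
  have ew: "polar q e w = 1"
    unfolding w_def using w1 e
    by (simp add: polar_add_right[OF qf] polar_smult_right[OF qf] ee)
  have qw: "q w = 0"
    unfolding w_def using w1 e polar_sym[OF w1(1) e(1), of q]
    by (simp add: quadratic_form_add quadratic_form_smult[OF qf] polar_smult_right[OF qf])
  obtain a y where ay: "a \<in> carrier_vec 1" "y \<in> carrier_vec k" "w = a @\<^sub>v y"
    using w by (rule append_vec_cases)
  \<comment> \<open>\<open>w\<close> is not a multiple of \<open>e\<close>, since multiples of
    \<open>e\<close> are orthogonal to \<open>e\<close>. So there is room for a second basis
    vector.\<close>
  have "y \<noteq> 0\<^sub>v k"
  proof
    assume "y = 0\<^sub>v k"
    then have "w = a $ 0 \<cdot>\<^sub>v e" unfolding ay e_def using ay(1) by (intro eq_vecI) auto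
    then show False using ew ee e by (simp add: polar_smult_right[OF qf])
  qed
  then obtain m where k: "k = 1 + m" using ay(2) by (cases k) auto
  obtain P where P: "P \<in> carrier_mat k k" "invertible_mat P" "P *\<^sub>v unit_vec k 0 = y"
    using ex_invertible_mat_unit_vec_0[OF ay(2) \<open>y \<noteq> 0\<^sub>v k\<close>] by blast
  \<comment> \<open>With \<open>a\<close> as first column of \<open>R\<close> and \<open>y\<close>
    as first column of \<open>P\<close>, the block matrix \<open>Q\<close> sends the second unit
    vector to \<open>w\<close>, and it fixes the first, \<open>e\<close>.\<close>
  define R where "R = mat 1 k (\<lambda>(i, j). if j = 0 then a $ 0 else 0)"
  have R: "R \<in> carrier_mat 1 k" "R *\<^sub>v unit_vec k 0 = a"
    unfolding R_def using ay(1) k by (auto intro!: eq_vecI)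
  define Q where "Q = four_block_mat (1\<^sub>m 1) R (0\<^sub>m k 1) P"
  have one: "invertible_mat (1\<^sub>m 1 :: 'a mat)" by (rule invertible_matI[of _ 1 "1\<^sub>m 1"]) auto
  have Q: "Q \<in> carrier_mat (1 + k) (1 + k)" "invertible_mat Q"
    unfolding Q_def using invertible_four_block_upper[OF one_carrier_mat one R(1) P(1,2)] P
    by auto
  have Qmult: "Q *\<^sub>v (x @\<^sub>v z) = (x + R *\<^sub>v z) @\<^sub>v (P *\<^sub>v z)"
    if "x \<in> carrier_vec 1" "z \<in> carrier_vec k" for x z
    unfolding Q_def
    by (subst four_block_mat_mult_vec[OF one_carrier_mat R(1) zero_carrier_mat P(1) that])
      (use that P in auto)
  have Qe: "Q *\<^sub>v unit_vec (2 + m) 0 = e"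
  proof -
    have e': "unit_vec (2 + m) 0 = (unit_vec 1 0 @\<^sub>v 0\<^sub>v k :: 'a vec)"
      by (simp add: unit_vec_append_zero k)
    have "Q *\<^sub>v (unit_vec 1 0 @\<^sub>v 0\<^sub>v k) = unit_vec 1 0 @\<^sub>v 0\<^sub>v k"
      using Qmult[of "unit_vec 1 0" "0\<^sub>v k"]
      by (simp add: mult_mat_zero_vec[OF R(1)] mult_mat_zero_vec[OF P(1)])
    then show ?thesis unfolding e' by (simp add: unit_vec_append_zero e_def)
  qed
  have Qw: "Q *\<^sub>v unit_vec (2 + m) 1 = w"
  proof -
    have e': "unit_vec (2 + m) 1 = (0\<^sub>v 1 @\<^sub>v unit_vec k 0 :: 'a vec)"
      by (simp add: zero_append_unit_vec k)
    show ?thesis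
      unfolding e' ay(3) Qmult[OF zero_carrier_vec unit_vec_carrier] R(2) P(3)
      using ay(1) by simp
  qed
  define p where "p v = q (Q *\<^sub>v v)" for v
  have p: "regular_form (2 + m) p"
    unfolding p_def using regular_form_mult_mat_vec[OF q Q] k by simp
  \<comment> \<open>The restriction to the plane spanned by the hyperbolic pair, in the new
    coordinates.\<close>
  define r where "r x = p (x @\<^sub>v 0\<^sub>v m)" for x
  have rf: "quadratic_form 2 r"
    unfolding r_def using quadratic_form_restrict p unfolding regular_form_def by blast
  have r0: "r (unit_vec 2 0) = 0" and r1: "r (unit_vec 2 1) = 0"
    unfolding r_def p_def by (simp_all add: unit_vec_append_zero Qe[simplified] Qw[simplified] e qw)
  have "polar r (unit_vec 2 0) (unit_vec 2 1) = polar p (unit_vec (2 + m) 0) (unit_vec (2 + m) 1)"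
  proof -
    have "(unit_vec 2 0 + unit_vec 2 1) @\<^sub>v 0\<^sub>v m = unit_vec (2 + m) 0 + (unit_vec (2 + m) 1 :: 'a vec)"
      by (intro eq_vecI) auto
    then show ?thesis unfolding polar_def r_def by (simp add: unit_vec_append_zero)
  qed
  also have "\<dots> = polar q e w"
    using polar_mult_mat_vec[OF Q(1), of "unit_vec (2 + m) 0" "unit_vec (2 + m) 1" q]
    unfolding p_def Qe Qw by (simp add: k)
  finally have r01: "polar r (unit_vec 2 0) (unit_vec 2 1) = 1" using ew by simp
  note plane = hyperbolic_plane[OF rf r0 r1 r01]
  obtain q' where q': "regular_form m q'" "isometric (2 + m) p (orth_sum 2 r m q')"
    using split_regular_restriction[OF p] plane(1) unfolding r_def by blast
  have "isometric (2 + m) q p" unfolding isometric_def p_def using Q k by auto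
  moreover have "isometric (2 + m) p (orth_sum 2 (hyperbolic 1) m q')"
    by (rule isometric_cong[OF q'(2)]) (simp add: orth_sum_def plane(2))
  ultimately show thesis using that k q'(1) isometric_trans by blast
qed

text \<open>A base change taking the first unit vector to an isotropic vector reduces this to the
  preceding lemma.\<close>

lemma split_hyperbolic_plane:
  fixes q :: "'a :: field vec \<Rightarrow> 'a"
  assumes q: "regular_form n q" and iso: "\<not> anisotropic n q"
  obtains m q' where "n = 2 + m" "regular_form m q'"
    "isometric n q (orth_sum 2 (hyperbolic 1) m q')"
proof -
  from iso obtain v where v: "v \<in> carrier_vec n" "v \<noteq> 0\<^sub>v n" "q v = 0"
    unfolding anisotropic_def by blast
  then obtain k where k: "n = 1 + k" by (cases n) auto
  obtain P where P: "P \<in> carrier_mat n n" "invertible_mat P" "P *\<^sub>v unit_vec n 0 = v"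
    using ex_invertible_mat_unit_vec_0[OF v(1,2)] by blast
  have "regular_form (1 + k) (\<lambda>v. q (P *\<^sub>v v))"
    using regular_form_mult_mat_vec[OF q P(1,2)] k by simp
  moreover have "q (P *\<^sub>v unit_vec (1 + k) 0) = 0" using P(3) v(3) k by simp
  ultimately obtain m q' where m: "k = 1 + m" "regular_form m q'"
    "isometric (2 + m) (\<lambda>v. q (P *\<^sub>v v)) (orth_sum 2 (hyperbolic 1) m q')"
    using split_hyperbolic_plane_unit_vec by blast
  have n: "n = 2 + m" using m k by simp
  have "isometric n q (\<lambda>v. q (P *\<^sub>v v))" unfolding isometric_def using P by auto
  with m(3) have "isometric n q (orth_sum 2 (hyperbolic 1) m q')"
    unfolding n by (metis isometric_trans)
  with that n m(2) show thesis by blast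
qed

section \<open>Existence of Witt decompositions and the vanishing of the Witt index\<close>

lemma hyperbolic_Suc:
  assumes "v \<in> carrier_vec (2 + 2 * r)"
  shows "orth_sum 2 (hyperbolic 1) (2 * r) (hyperbolic r) v = hyperbolic (Suc r) v"
proof -
  obtain x y where "x \<in> carrier_vec 2" "y \<in> carrier_vec (2 * r)" "v = x @\<^sub>v y"
    using assms by (rule append_vec_cases)
  \<comment> \<open>Coordinates 2 i and 2 i + 1 are paired, so the plane put in front is the summand
    with index 0 and the others shift by one.\<close>
  then show ?thesis by (simp add: hyperbolic_def sum.lessThan_Suc_shift del: sum.lessThan_Suc)
qed

lemma orth_sum_zero_hyperbolic:
  assumes "v \<in> carrier_vec n"
  shows "orth_sum (2 * 0) (hyperbolic 0) n q v = q v"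
proof -
  have "vec_last v n = v" using assms unfolding vec_last_def by (intro eq_vecI) auto
  then show ?thesis by (simp add: orth_sum_def hyperbolic_def)
qed

text \<open>Strong induction on the dimension, splitting off one plane as long as the form is
  isotropic. The last clause records that the construction stops at \<open>r = 0\<close> only for
  anisotropic forms.\<close>

lemma witt_decomposition:
  fixes q :: "'a :: field vec \<Rightarrow> 'a"
  assumes "regular_form n q"
  shows "\<exists>r m q_an. n = 2 * r + m \<and> regular_form m q_an \<and> anisotropic m q_an \<and>
    isometric n q (orth_sum (2 * r) (hyperbolic r) m q_an) \<and> (r = 0 \<longrightarrow> anisotropic n q)"
  using assms
proof (induction n arbitrary: q rule: less_induct)
  case (less n)
  show ?case
  proof (cases "anisotropic n q")
    case True
    have "isometric n q (orth_sum (2 * 0) (hyperbolic 0) n q)"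
      by (rule isometric_cong[OF isometric_refl]) (rule orth_sum_zero_hyperbolic[symmetric])
    then show ?thesis using True less.prems by (intro exI[of _ 0] exI[of _ n] exI[of _ q]) simp
  next
    case False
    then obtain m q' where m: "n = 2 + m" "regular_form m q'"
      "isometric n q (orth_sum 2 (hyperbolic 1) m q')"
      using split_hyperbolic_plane[OF less.prems] by blast
    obtain r k q_an where r: "m = 2 * r + k" "regular_form k q_an" "anisotropic k q_an"
      "isometric m q' (orth_sum (2 * r) (hyperbolic r) k q_an)"
      using less.IH[OF _ m(2)] m(1) by auto
    let ?s = "orth_sum 2 (hyperbolic 1) m (orth_sum (2 * r) (hyperbolic r) k q_an)"
    have "isometric n q ?s"
      using isometric_trans[OF m(3)] isometric_orth_sum_right[OF r(4)] m(1) by blast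
    moreover have "?s v = orth_sum (2 * Suc r) (hyperbolic (Suc r)) k q_an v"
      if "v \<in> carrier_vec n" for v
    proof -
      \<comment> \<open>Reassociating puts the new plane next to the other \<open>r\<close>, with
        which it merges.\<close>
      have "?s v = orth_sum (2 + 2 * r) (orth_sum 2 (hyperbolic 1) (2 * r) (hyperbolic r)) k q_an v"
        using that orth_sum_assoc[of v 2 "2 * r" k] m r by simp
      also have "\<dots> = orth_sum (2 * Suc r) (hyperbolic (Suc r)) k q_an v"
        using hyperbolic_Suc[of "vec_first v (2 + 2 * r)" r]
        by (simp add: orth_sum_def[of "2 + 2 * r"] orth_sum_def[of "Suc (Suc (2 * r))"])
      finally show ?thesis .
    qed
    ultimately have "isometric n q (orth_sum (2 * Suc r) (hyperbolic (Suc r)) k q_an)"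
      by (rule isometric_cong)
    moreover have "n = 2 * Suc r + k" using m r by simp
    ultimately show ?thesis using r(2,3) by blast
  qed
qed

text \<open>The form XY vanishes on the first axis.\<close>

lemma not_anisotropic_hyperbolic:
  fixes q :: "'a :: field vec \<Rightarrow> 'a"
  assumes "quadratic_form m q" "r > 0"
  shows "\<not> anisotropic (2 * r + m) (orth_sum (2 * r) (hyperbolic r) m q)"
proof
  assume "anisotropic (2 * r + m) (orth_sum (2 * r) (hyperbolic r) m q)"
  moreover let ?e = "unit_vec (2 * r) 0 :: 'a vec"
  have "orth_sum (2 * r) (hyperbolic r) m q (?e @\<^sub>v 0\<^sub>v m) = 0"
    using quadratic_form_zero[OF assms(1)] by (simp add: hyperbolic_def)
  ultimately have "?e @\<^sub>v 0\<^sub>v m = 0\<^sub>v (2 * r + m)" unfolding anisotropic_def by auto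
  then show False using assms(2) append_eq_zero_vec_iff[of ?e "2 * r" "0\<^sub>v m" m] by auto
qed

text \<open>If the greatest admissible \<open>r\<close> is 0, so is the \<open>r\<close> of the
  constructed decomposition, and its last clause applies. Conversely, a positive index makes the
  form isometric to one containing a hyperbolic plane.\<close>

lemma witt_index_eq_0_iff:
  fixes q :: "'a :: field vec \<Rightarrow> 'a"
  assumes q: "regular_form n q"
  shows "witt_index n q = 0 \<longleftrightarrow> anisotropic n q"
proof -
  define W where "W r \<longleftrightarrow> (\<exists>m q_an. n = 2 * r + m \<and> regular_form m q_an \<and> anisotropic m q_an \<and>
    isometric n q (orth_sum (2 * r) (hyperbolic r) m q_an))" for r
  have idx: "witt_index n q = Greatest W" unfolding witt_index_def W_def ..
  have bound: "r \<le> n" if "W r" for r using that unfolding W_def by auto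
  obtain r where r: "W r" "r = 0 \<longrightarrow> anisotropic n q"
    using witt_decomposition[OF q] unfolding W_def by blast
  \<comment> \<open>\<open>GREATEST\<close> is meaningful because the admissible \<open>r\<close>
    exist and are bounded by the dimension.\<close>
  have W: "W (witt_index n q)" unfolding idx by (rule GreatestI_nat[where P = W, OF r(1) bound])
  show ?thesis
  proof
    assume "witt_index n q = 0"
    with Greatest_le_nat[where P = W, OF r(1) bound] r(2) show "anisotropic n q" unfolding idx by simp
  next
    assume an: "anisotropic n q"
    obtain m q_an where n: "n = 2 * witt_index n q + m" and "regular_form m q_an"
      and iso: "isometric n q (orth_sum (2 * witt_index n q) (hyperbolic (witt_index n q)) m q_an)"
      using W unfolding W_def by blast
    then show "witt_index n q = 0"
      using isometric_anisotropic[OF iso an] not_anisotropic_hyperbolic[of m q_an "witt_index n q"]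
      unfolding regular_form_def by (metis gr0I)
  qed
qed

section \<open>The invariants\<close>

lemma two_neq_zero_if_CHAR_neq_2:
  assumes "CHAR('a :: field) \<noteq> 2"
  shows "(2 :: 'a) \<noteq> 0"
proof
  assume "(2 :: 'a) = 0"
  then have "CHAR('a) dvd 2" using of_nat_eq_0_iff_char_dvd[where 'a = 'a, of 2] by simp
  then have "CHAR('a) = 1" using assms prime_nat_iff[of 2] two_is_prime_nat by blast
  then show False by simp
qed

lemma one_dim_form:
  assumes "quadratic_form 1 q" "x \<in> carrier_vec 1"
  shows "q x = (x $ 0)\<^sup>2 * q (unit_vec 1 0)"
proof -
  have "x = x $ 0 \<cdot>\<^sub>v unit_vec 1 0" using assms by (intro eq_vecI) auto
  then show ?thesis using quadratic_form_smult[OF assms(1) unit_vec_carrier] by metis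
qed

text \<open>This is the form \<langle>1\<rangle>, the witness both for \<open>u \<ge> 1\<close> and
  for the value 1 of the other invariant.\<close>

lemma square_form:
  assumes "(2 :: 'a :: field) \<noteq> 0"
  shows "regular_form 1 (\<lambda>v :: 'a vec. (v $ 0)\<^sup>2)" "anisotropic 1 (\<lambda>v :: 'a vec. (v $ 0)\<^sup>2)"
proof -
  show a: "anisotropic 1 (\<lambda>v :: 'a vec. (v $ 0)\<^sup>2)"
    unfolding anisotropic_def by (auto intro!: eq_vecI)
  have "quadratic_form 1 (\<lambda>v :: 'a vec. (v $ 0)\<^sup>2)"
    unfolding quadratic_form_def polar_def by (auto simp: power2_eq_square algebra_simps)
  from anisotropic_imp_regular[OF assms this a] show "regular_form 1 (\<lambda>v :: 'a vec. (v $ 0)\<^sup>2)" .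
qed

lemma regular_form_scale:
  fixes q :: "'a :: field vec \<Rightarrow> 'a"
  assumes "regular_form n q" "c \<noteq> 0"
  shows "regular_form n (\<lambda>v. c * q v)"
proof -
  have "polar (\<lambda>v. c * q v) v w = c * polar q v w" for v w
    by (simp add: polar_def algebra_simps)
  with assms show ?thesis
    unfolding regular_form_def quadratic_form_def by (simp add: algebra_simps)
qed

lemma anisotropic_restrict:
  assumes "anisotropic (n + m) q"
  shows "anisotropic n (\<lambda>x. q (x @\<^sub>v 0\<^sub>v m))"
  unfolding anisotropic_def
proof (intro ballI impI)
  fix x assume x: "x \<in> carrier_vec n" "q (x @\<^sub>v 0\<^sub>v m) = 0"
  with assms have "x @\<^sub>v 0\<^sub>v m = 0\<^sub>v (n + m)" unfolding anisotropic_def by simp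
  with x(1) show "x = 0\<^sub>v n" using append_eq_zero_vec_iff[of x n "0\<^sub>v m" m] by simp
qed

text \<open>Any two nonzero one-dimensional forms agree up to a scalar, and scaling preserves
  anisotropy. So it suffices to find some anisotropic sum of dimension \<open>1 + i\<close> and
  scale it to begin with \<open>q\<close>.\<close>

lemma one_dim_complement:
  fixes q \<rho> :: "'a :: field vec \<Rightarrow> 'a"
  assumes two: "(2 :: 'a) \<noteq> 0"
    and q: "regular_form 1 q" "anisotropic 1 q"
    and \<rho>: "regular_form n \<rho>" "anisotropic n \<rho>" "i < n"
  obtains \<sigma> where "regular_form i \<sigma>" "anisotropic (1 + i) (orth_sum 1 q i \<sigma>)"
proof -
  \<comment> \<open>Only the first \<open>1 + i\<close> coordinates of \<open>\<rho>\<close> are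
    kept; \<open>\<rho>0\<close> below is the restriction to the first axis.\<close>
  from \<rho>(3) obtain k where n: "n = (1 + i) + k" using less_iff_Suc_add by auto
  define \<rho>1 where "\<rho>1 x = \<rho> (x @\<^sub>v 0\<^sub>v k)" for x
  have \<rho>1: "quadratic_form (1 + i) \<rho>1" "anisotropic (1 + i) \<rho>1"
    unfolding \<rho>1_def using \<rho>(1,2) quadratic_form_restrict anisotropic_restrict
    unfolding n regular_form_def by blast+
  note reg1 = anisotropic_imp_regular[OF two \<rho>1]
  define \<rho>0 where "\<rho>0 x = \<rho>1 (x @\<^sub>v 0\<^sub>v i)" for x
  have \<rho>0: "quadratic_form 1 \<rho>0" "anisotropic 1 \<rho>0"
    unfolding \<rho>0_def using \<rho>1 quadratic_form_restrict anisotropic_restrict by blast+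
  obtain \<tau> where \<tau>: "regular_form i \<tau>" "isometric (1 + i) \<rho>1 (orth_sum 1 \<rho>0 i \<tau>)"
    using split_regular_restriction[OF reg1] anisotropic_imp_regular[OF two \<rho>0]
    unfolding \<rho>0_def by blast
  have an: "anisotropic (1 + i) (orth_sum 1 \<rho>0 i \<tau>)"
    using isometric_anisotropic[OF \<tau>(2) \<rho>1(2)] .
  define a where "a = q (unit_vec 1 0)"
  define b where "b = \<rho>0 (unit_vec 1 0)"
  have ab: "a \<noteq> 0" "b \<noteq> 0"
    using q(2) \<rho>0(2) unit_vec_carrier[of 1 0] unit_vec_nonzero[of 0 1]
    unfolding a_def b_def anisotropic_def by (metis less_numeral_extra(1))+
  \<comment> \<open>The factor turns \<open>\<rho>0\<close>, with value \<open>b\<close> at the unit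
    vector, into \<open>q\<close>, with value \<open>a\<close> there.\<close>
  define \<sigma> where "\<sigma> y = a / b * \<tau> y" for y
  have "regular_form i \<sigma>" unfolding \<sigma>_def by (rule regular_form_scale[OF \<tau>(1)]) (use ab in simp)
  moreover have "anisotropic (1 + i) (orth_sum 1 q i \<sigma>)"
  proof -
    have "orth_sum 1 q i \<sigma> v = a / b * orth_sum 1 \<rho>0 i \<tau> v" if "v \<in> carrier_vec (1 + i)" for v
    proof -
      have "q x = a / b * \<rho>0 x" if "x \<in> carrier_vec 1" for x
        using one_dim_form[OF _ that, of q] one_dim_form[OF \<rho>0(1) that] q(1) ab
        unfolding regular_form_def a_def b_def by simp
      then show ?thesis by (simp add: orth_sum_def \<sigma>_def distrib_left)
    qed
    then show ?thesis using an ab unfolding anisotropic_def by simp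
  qed
  ultimately show thesis using that by blast
qed

section \<open>Recovering the bounds on u from the values of m\<close>

lemma u_invariant_le_iff:
  "u_invariant TYPE('a :: field) \<le> enat i \<longleftrightarrow>
    (\<forall>n (q :: 'a vec \<Rightarrow> 'a). regular_form n q \<longrightarrow> anisotropic n q \<longrightarrow> n \<le> i)"
  unfolding u_invariant_def Sup_le_iff by (auto 4 4)

text \<open>This settles the bound 0 in the final comparison, where the hypothesis on the indices
  \<open>i \<ge> 1\<close> says nothing.\<close>

lemma u_invariant_ge_1:
  assumes "(2 :: 'a :: field) \<noteq> 0"
  shows "u_invariant TYPE('a) \<ge> 1"
  unfolding u_invariant_def one_enat_def
  by (rule Sup_upper) (use square_form[OF assms] in blast)

lemma m_invariant_eq_1_iff:
  assumes two: "(2 :: 'a :: field) \<noteq> 0"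
  shows "m_invariant TYPE('a) i 1 = 1 \<longleftrightarrow> u_invariant TYPE('a) \<le> enat i"
proof -
  define S where "S = {enat n | n. n \<ge> 1 \<and>
     (\<exists>q :: 'a vec \<Rightarrow> 'a. regular_form n q \<and> witt_index n q < 1 \<and>
        (\<forall>\<sigma>. regular_form i \<sigma> \<longrightarrow> witt_index (n + i) (orth_sum n q i \<sigma>) \<ge> 1))}"
  have m: "m_invariant TYPE('a) i 1 = Inf S" unfolding m_invariant_def S_def ..
  show ?thesis
  proof
    assume "m_invariant TYPE('a) i 1 = 1"
    \<comment> \<open>An infimum below 2 is witnessed by an element below 2, which must be 1. This
      gives an actual one-dimensional form.\<close>
    then have "Inf S < enat 2" unfolding m by (simp add: one_enat_def)
    then obtain x where x: "x \<in> S" "x < enat 2" unfolding Inf_less_iff by blast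
    then obtain n where n: "x = enat n" "n \<ge> 1" unfolding S_def by blast
    with x(2) have "n = 1" by simp
    with x(1) n(1) have "enat 1 \<in> S" by simp
    then obtain q :: "'a vec \<Rightarrow> 'a" where q: "regular_form 1 q" "witt_index 1 q = 0"
      "\<And>\<sigma>. regular_form i \<sigma> \<Longrightarrow> witt_index (1 + i) (orth_sum 1 q i \<sigma>) \<noteq> 0"
      unfolding S_def by fastforce
    have aq: "anisotropic 1 q" using q(2) witt_index_eq_0_iff[OF q(1)] by simp
    show "u_invariant TYPE('a) \<le> enat i"
      unfolding u_invariant_le_iff
    proof (intro allI impI, rule ccontr)
      fix n and \<rho> :: "'a vec \<Rightarrow> 'a"
      assume "regular_form n \<rho>" "anisotropic n \<rho>" "\<not> n \<le> i"
      then obtain \<sigma> where \<sigma>: "regular_form i \<sigma>" "anisotropic (1 + i) (orth_sum 1 q i \<sigma>)"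
        using one_dim_complement[OF two q(1) aq, of n \<rho> i] by auto
      then show False
        using q(3)[OF \<sigma>(1)] witt_index_eq_0_iff[OF regular_form_orth_sum[OF q(1) \<sigma>(1)]] by simp
    qed
  next
    assume u: "u_invariant TYPE('a) \<le> enat i"
    let ?q = "\<lambda>v :: 'a vec. (v $ 0)\<^sup>2"
    note sq = square_form[OF two]
    have "witt_index 1 ?q = 0" using witt_index_eq_0_iff[OF sq(1)] sq(2) by simp
    \<comment> \<open>The sum has dimension \<open>1 + i\<close>, which exceeds u, so it is
      isotropic.\<close>
    moreover have "witt_index (1 + i) (orth_sum 1 ?q i \<sigma>) \<noteq> 0" if "regular_form i \<sigma>" for \<sigma>
    proof -
      note reg = regular_form_orth_sum[OF sq(1) that]
      then have "\<not> anisotropic (1 + i) (orth_sum 1 ?q i \<sigma>)"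
        using u unfolding u_invariant_le_iff by (metis Suc_n_not_le_n plus_1_eq_Suc)
      then show ?thesis using witt_index_eq_0_iff[OF reg] by simp
    qed
    ultimately have "enat 1 \<in> S"
      unfolding S_def using sq(1) by (auto simp: Suc_le_eq intro!: exI[of _ ?q])
    then have "Inf S \<le> 1" by (simp add: Inf_lower one_enat_def)
    moreover have "1 \<le> Inf S" unfolding S_def one_enat_def by (rule Inf_greatest) auto
    ultimately show "m_invariant TYPE('a) i 1 = 1" unfolding m by simp
  qed
qed

theorem theorem3p16:
  assumes "CHAR('k :: field) \<noteq> 2"
    and "CHAR('l :: field) \<noteq> 2"
    and "\<forall>i \<ge> 1. m_invariant TYPE('k) i 1 = m_invariant TYPE('l) i 1"
  shows "u_invariant TYPE('k) = u_invariant TYPE('l)"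
proof -
  note two = two_neq_zero_if_CHAR_neq_2[OF assms(1)] two_neq_zero_if_CHAR_neq_2[OF assms(2)]
  have *: "u_invariant TYPE('k) \<le> enat i \<longleftrightarrow> u_invariant TYPE('l) \<le> enat i" for i
  proof (cases "i \<ge> 1")
    case True
    then show ?thesis
      using assms(3) m_invariant_eq_1_iff[OF two(1), of i] m_invariant_eq_1_iff[OF two(2), of i]
      by simp
  next
    case False
    \<comment> \<open>Only \<open>i = 0\<close> remains, and there both sides are false.\<close>
    have "\<not> (1 :: enat) \<le> enat 0" by (simp add: one_enat_def)
    with False u_invariant_ge_1[OF two(1)] u_invariant_ge_1[OF two(2)] show ?thesis
      by (metis One_nat_def Suc_le_eq not_gr_zero order_trans)
  qed
  \<comment> \<open>An extended natural number is determined by its finite upper bounds; \<infinity>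
    is the one that has none.\<close>
  have "x = y" if "\<And>i. x \<le> enat i \<longleftrightarrow> y \<le> enat i" for x y :: enat
    using that by (metis enat_ord_code(3) not_infinity_eq order_antisym order_refl)
  with * show ?thesis by blast
qed

end
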